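(* Let $f:\mathbb{R}^n\times\mathbb{R}^m\to\mathbb{R}^n$ be a $C^1$ function with $f(0,0)=0$, and consider the discrete-time time-invariant system $x(t+1)=f(x(t),u(t))$, $t\in\mathbb{Z}_{\ge 0}$, with state $x(t)\in\mathbb{R}^n$ and input $u(t)\in\mathbb{R}^m$. If the system is asymptotically controllable to the origin and rank controllable at the origin, then it is finite-time stabilizable by a state feedback controller.
   Context: For an initial state $x_0\in\mathbb{R}^n$ and an input sequence $u=(u(0),u(1),\dots)$ defined at least on times $0,\dots,t-1$, $\phi(t,0,x_0,u)$ denotes the trajectory of the system: $\phi(0,0,x_0,u)=x_0$ and $\phi(t,0,x_0,u)=f(\phi(t-1,0,x_0,u),u(t-1))$ for $t\ge 1$. For fixed $N$, $\phi(N,0,x_0,u)$ is regarded as a function of $x_0$ and of $u[0,N-1]=(u(0),\dots,u(N-1))$. Asymptotically controllable to the origin: for every $x_0\in\mathbb{R}^n$ there exists an infinite input sequence $(u(0),u(1),\dots)$ in $\mathbb{R}^m$ such that $\phi(t,0,x_0,u)\to 0$ as $t\to\infty$. Rank controllable at the origin: there exists an integer $N>0$ such that $$\operatorname{rank}\frac{\partial \phi(N,0,x_0,u)}{\partial u[0,N-1]}=n$$ at all points of some open neighborhood of $(x_0,u(0),\dots,u(N-1))=(0,0,\dots,0)$, where the partial derivative is the $n\times Nm$ Jacobian matrix with respect to the stacked vector $(u(0)^T,u(1)^T,\dots,u(N-1)^T)^T\in\mathbb{R}^{Nm}$. A state feedback controller (control law) is a function $\upsilon:\mathbb{R}^n\to\mathbb{R}^m$,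 time-invariant and possibly discontinuous. The closed-loop trajectory $\phi(t,0,x_0;\upsilon(x))$ is the sequence $x_t$ with initial value $x_0$ and $x_{t+1}=f(x_t,\upsilon(x_t))$. Finite-time stabilizable by a state feedback controller (globally): there is a control law $\upsilon:\mathbb{R}^n\to\mathbb{R}^m$ such that for every $x_0\in\mathbb{R}^n$ there exists an integer $N_{x}>0$ (possibly depending on $x_0$) with $\phi(N_{x},0,x_0;\upsilon(x))=0$. *)

theory Defs
  imports "HOL-Analysis.Analysis"
begin

definition C1_map :: "('a::real_normed_vector \<Rightarrow> 'b::real_normed_vector) \<Rightarrow> bool" where
  "C1_map f \<longleftrightarrow>
     (\<exists>f' :: 'a \<Rightarrow> 'a \<Rightarrow>\<^sub>L 'b.
        (\<forall>x. (f has_derivative blinfun_apply (f' x)) (at x)) \<and> continuous_on UNIV f')"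

text \<open>Only the inputs \<open>u 0, \<dots>, u (t - 1)\<close> influence the state at time \<open>t\<close>.\<close>

primrec traj ::
  "((real^'n) \<times> (real^'m) \<Rightarrow> real^'n) \<Rightarrow> nat \<Rightarrow> real^'n \<Rightarrow> (nat \<Rightarrow> real^'m) \<Rightarrow> real^'n" where
  "traj f 0 x0 u = x0"
| "traj f (Suc t) x0 u = f (traj f t x0 u, u t)"

primrec closed_loop_traj ::
  "((real^'n) \<times> (real^'m) \<Rightarrow> real^'n) \<Rightarrow> (real^'n \<Rightarrow> real^'m) \<Rightarrow> nat \<Rightarrow> real^'n \<Rightarrow> real^'n" where
  "closed_loop_traj f v 0 x0 = x0"
| "closed_loop_traj f v (Suc t) x0 =
     f (closed_loop_traj f v t x0, v (closed_loop_traj f v t x0))"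

definition asymptotically_controllable ::
  "((real^'n) \<times> (real^'m) \<Rightarrow> real^'n) \<Rightarrow> bool" where
  "asymptotically_controllable f \<longleftrightarrow> (\<forall>x0. \<exists>u. (\<lambda>t. traj f t x0 u) \<longlonglongrightarrow> 0)"

text \<open>
  The Jacobian of the state at time \<open>N\<close> with respect to the stacked vector
  \<open>(u 0, \<dots>, u (N - 1))\<close> is the block matrix \<open>[J 0 | \<dots> | J (N - 1)]\<close>, where \<open>J k\<close> is the
  Jacobian with respect to \<open>u k\<close>. Its width depends on the number \<open>N\<close>, so it is kept as its
  family of blocks; its columns are those of all the blocks, and its rank is the dimension of
  the space they span.
\<close>

definition input_jacobian_block ::
  "((real^'n) \<times> (real^'m) \<Rightarrow> real^'n) \<Rightarrow> nat \<Rightarrow> real^'n \<Rightarrow> (nat \<Rightarrow> real^'m) \<Rightarrow> nat \<Rightarrow> real^'m^'n" where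
  "input_jacobian_block f N x0 u k = jacobian (\<lambda>w. traj f N x0 (u(k := w))) (at (u k))"

definition input_jacobian_rank ::
  "((real^'n) \<times> (real^'m) \<Rightarrow> real^'n) \<Rightarrow> nat \<Rightarrow> real^'n \<Rightarrow> (nat \<Rightarrow> real^'m) \<Rightarrow> nat" where
  "input_jacobian_rank f N x0 u = dim (\<Union>k<N. columns (input_jacobian_block f N x0 u k))"

text \<open>
  The space of pairs \<open>(x0, u[0, N - 1])\<close> is the product of the state space with the
  \<open>N\<close>-fold power of the input space, whose points are functions that are \<open>undefined\<close>
  outside \<open>{..<N}\<close>.
\<close>

definition rank_controllable_at_origin ::
  "((real^'n) \<times> (real^'m) \<Rightarrow> real^'n) \<Rightarrow> bool" where
  "rank_controllable_at_origin f \<longleftrightarrow>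
     (\<exists>N>0. \<exists>W. openin (prod_topology euclidean (product_topology (\<lambda>_. euclidean) {..<N})) W \<and>
        (0, \<lambda>k\<in>{..<N}. 0) \<in> W \<and>
        (\<forall>(x0, u)\<in>W. input_jacobian_rank f N x0 u = CARD('n)))"

definition finite_time_stabilizable ::
  "((real^'n) \<times> (real^'m) \<Rightarrow> real^'n) \<Rightarrow> bool" where
  "finite_time_stabilizable f \<longleftrightarrow>
     (\<exists>v. \<forall>x0. \<exists>N>0. closed_loop_traj f v N x0 = 0)"

end

theory Submission
  imports Defs
begin

text \<open>
  Call a state null-controllable if some input sequence drives it to the origin in finitely many
  steps. The theorem splits into two parts.

  Every state is null-controllable. Asymptotic controllability brings any state arbitrarily close
  to the origin, so it suffices to treat states near the origin. Linearizing at the origin, the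
  rank condition says that the linearized system reaches every state from the origin in \<open>N\<close> steps.
  Choosing inputs that reach the basis vectors gives inputs \<open>L p\<close>, linear in a parameter
  \<open>p\<close> of the same dimension as the state, such that \<open>F (x, p) = traj f N x (L p)\<close> has a derivative
  at the origin that is the identity in the direction of \<open>p\<close>. The map \<open>(x, p) \<mapsto> (x, F (x, p))\<close> is
  then open at the origin (\<open>sussmann_open_mapping\<close>), so for each small \<open>x\<close> the point \<open>(x, 0)\<close> is a
  value, that is, \<open>F (x, p) = 0\<close> for some \<open>p\<close> (\<open>locally_null_controllable\<close>).

  Null-controllability gives a feedback. Let \<open>v x\<close> be the first input of an input sequence that
  steers \<open>x\<close> to the origin in minimal time. The rest of that sequence shows that the minimal time
  of the next state is smaller, so the closed loop arrives at the origin
  (\<open>null_controllable_imp_finite_time_stabilizable\<close>).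
\<close>

section \<open>Trajectories\<close>

lemma traj_cong:
  assumes "\<And>k. k < t \<Longrightarrow> u k = w k"
  shows "traj f t x u = traj f t x w"
  using assms by (induction t) auto

lemma traj_add: "traj f (s + t) x u = traj f t (traj f s x u) (\<lambda>k. u (s + k))"
  by (induction t) auto

lemma traj_Suc_shift: "traj f (Suc t) x u = traj f t (f (x, u 0)) (\<lambda>k. u (Suc k))"
  using traj_add[of f 1 t x u] by simp

lemma closed_loop_traj_Suc_shift:
  "closed_loop_traj f v (Suc t) x = closed_loop_traj f v t (f (x, v x))"
  by (induction t) auto

lemma traj_concat:
  "traj f (s + t) x (\<lambda>k. if k < s then u k else w (k - s)) = traj f t (traj f s x u) w"
proof -
  have "traj f s x (\<lambda>k. if k < s then u k else w (k - s)) = traj f s x u"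
    by (rule traj_cong) simp
  then show ?thesis
    by (simp add: traj_add)
qed

lemma continuous_on_traj:
  assumes "continuous_on UNIV f" "continuous_on S X" "\<And>k. continuous_on S (U k)"
  shows "continuous_on S (\<lambda>p. traj f t (X p) (\<lambda>k. U k p))"
proof (induction t)
  case 0
  then show ?case using assms by simp
next
  case (Suc t)
  have "continuous_on S (\<lambda>p. f (traj f t (X p) (\<lambda>k. U k p), U t p))"
    by (rule continuous_on_compose2[OF assms(1)]) (auto intro!: continuous_intros Suc assms)
  then show ?case by simp
qed

section \<open>Linear systems and linearization at the origin\<close>

lemma traj_linear_scaleR:
  assumes "linear A"
  shows "traj A t (c *\<^sub>R x) (\<lambda>k. c *\<^sub>R u k) = c *\<^sub>R traj A t x u"
proof (induction t)
  case (Suc t)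
  then show ?case using linear_scale[OF assms, of c "(traj A t x u, u t)"] by simp
qed simp

lemma traj_linear_add:
  assumes "linear A"
  shows "traj A t (x + y) (\<lambda>k. u k + w k) = traj A t x u + traj A t y w"
proof (induction t)
  case (Suc t)
  then show ?case using linear_add[OF assms, of "(traj A t x u, u t)" "(traj A t y w, w t)"] by simp
qed simp

lemma traj_linear_zero:
  assumes "linear A"
  shows "traj A t 0 (\<lambda>_. 0) = 0"
  using traj_linear_scaleR[OF assms, of t 0 0 "\<lambda>_. 0"] by simp

lemma traj_linear_sum:
  assumes "linear A"
  shows "traj A t 0 (\<lambda>k. \<Sum>i\<in>I. c i *\<^sub>R u i k) = (\<Sum>i\<in>I. c i *\<^sub>R traj A t 0 (u i))"
proof (induction I rule: infinite_finite_induct)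
  case (insert i I)
  have "traj A t 0 (\<lambda>k. c i *\<^sub>R u i k) = c i *\<^sub>R traj A t 0 (u i)"
    using traj_linear_scaleR[OF assms, of t "c i" 0 "u i"] by simp
  then show ?case
    using insert traj_linear_add[OF assms, of t 0 0 "\<lambda>k. c i *\<^sub>R u i k" "\<lambda>k. \<Sum>i\<in>I. c i *\<^sub>R u i k"]
    by simp
qed (simp_all add: traj_linear_zero[OF assms])

text \<open>
  Since the zero trajectory is an equilibrium, the chain rule meets the same derivative \<open>A\<close> of \<open>f\<close>
  at every step, so the derivative of a trajectory is a trajectory of the time-invariant system \<open>A\<close>.
\<close>

lemma traj_has_derivative_at_origin:
  fixes X :: "'a::real_normed_vector \<Rightarrow> real^'n" and U :: "nat \<Rightarrow> 'a \<Rightarrow> real^'m"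
  assumes f: "(f has_derivative A) (at (0, 0))" "f (0, 0) = 0"
    and X: "(X has_derivative X') (at z)" "X z = 0"
    and U: "\<And>k. k < t \<Longrightarrow> (U k has_derivative U' k) (at z)" "\<And>k. k < t \<Longrightarrow> U k z = 0"
  shows "traj f t (X z) (\<lambda>k. U k z) = 0 \<and>
    ((\<lambda>p. traj f t (X p) (\<lambda>k. U k p)) has_derivative (\<lambda>h. traj A t (X' h) (\<lambda>k. U' k h))) (at z)"
  using U
proof (induction t)
  case 0
  then show ?case using X by simp
next
  case (Suc t)
  let ?g = "\<lambda>p. (traj f t (X p) (\<lambda>k. U k p), U t p)"
  have IH: "traj f t (X z) (\<lambda>k. U k z) = 0"
    "((\<lambda>p. traj f t (X p) (\<lambda>k. U k p)) has_derivative (\<lambda>h. traj A t (X' h) (\<lambda>k. U' k h))) (at z)"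
    using Suc by auto
  have gz: "?g z = (0, 0)"
    using IH(1) Suc.prems(2) by simp
  have g: "(?g has_derivative (\<lambda>h. (traj A t (X' h) (\<lambda>k. U' k h), U' t h))) (at z)"
    using IH(2) Suc.prems(1) by (intro has_derivative_Pair) auto
  have "((\<lambda>p. f (?g p)) has_derivative
      (\<lambda>h. A (traj A t (X' h) (\<lambda>k. U' k h), U' t h))) (at z)"
    by (rule has_derivative_compose[OF g]) (use f(1) gz in simp)
  then show ?case using gz f(2) by simp
qed

text \<open>
  The columns of the input Jacobian are states reached from the origin by the linearized system
  under an impulse in one input coordinate. The reachable states form a subspace, so full rank
  makes every state reachable.
\<close>

lemma full_rank_imp_linearization_reachable:
  fixes f :: "(real^'n) \<times> (real^'m) \<Rightarrow> real^'n"
  assumes f: "(f has_derivative A) (at (0, 0))" "f (0, 0) = 0"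
    and u: "\<And>k. k < N \<Longrightarrow> u k = 0"
    and rank: "input_jacobian_rank f N 0 u = CARD('n)"
  shows "\<exists>w. traj A N 0 w = y"
proof -
  let ?R = "range (traj A N 0)"
  have A: "linear A"
    using f(1) by (rule has_derivative_linear)
  have "subspace ?R"
  proof (rule subspaceI)
    show "0 \<in> ?R"
      by (rule range_eqI[of _ _ "\<lambda>_. 0"]) (simp add: traj_linear_zero[OF A])
  next
    fix a b assume "a \<in> ?R" "b \<in> ?R"
    then obtain v w where "a = traj A N 0 v" "b = traj A N 0 w" by auto
    then show "a + b \<in> ?R"
      using traj_linear_add[OF A, of N 0 0 v w] by (auto intro!: range_eqI[of _ _ "\<lambda>k. v k + w k"])
  next
    fix a c assume "a \<in> ?R"
    then obtain v where "a = traj A N 0 v" by auto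
    then show "c *\<^sub>R a \<in> ?R"
      using traj_linear_scaleR[OF A, of N c 0 v] by (auto intro!: range_eqI[of _ _ "\<lambda>k. c *\<^sub>R v k"])
  qed
  moreover have "columns (input_jacobian_block f N 0 u k) \<subseteq> ?R" if k: "k < N" for k
  proof -
    let ?D = "\<lambda>w. traj A N 0 (\<lambda>i. if i = k then w else 0)"
    have coord: "((\<lambda>w. (u(k := w)) i) has_derivative (\<lambda>w. if i = k then w else 0)) (at 0)" for i
      by (cases "i = k") auto
    have "((\<lambda>w. traj f N 0 (\<lambda>i. (u(k := w)) i)) has_derivative ?D) (at 0)"
      using traj_has_derivative_at_origin[OF f, of "\<lambda>_. 0" "\<lambda>_. 0" 0 N "\<lambda>i w. (u(k := w)) i"
          "\<lambda>i w. if i = k then w else 0"] coord u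
      by simp
    then have D: "?D = frechet_derivative (\<lambda>w. traj f N 0 (u(k := w))) (at (u k))"
      unfolding u[OF k] by (rule frechet_derivative_at)
    then have "column j (input_jacobian_block f N 0 u k) = ?D (axis j 1)" for j
      by (simp add: input_jacobian_block_def jacobian_def matrix_def column_def vec_eq_iff
          flip: D)
    then show ?thesis
      unfolding columns_def by auto
  qed
  ultimately have "span (\<Union>k<N. columns (input_jacobian_block f N 0 u k)) \<subseteq> ?R"
    by (intro span_minimal) auto
  moreover have "span (\<Union>k<N. columns (input_jacobian_block f N 0 u k)) = UNIV"
    using rank dim_eq_full[of "\<Union>k<N. columns (input_jacobian_block f N 0 u k)"]
    by (simp add: input_jacobian_rank_def)
  ultimately have "y \<in> ?R" by blast
  then show ?thesis by auto
qed

section \<open>Null-controllability\<close>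

text \<open>
  The inputs form a space that depends on \<open>N\<close>. Restricting them to a family \<open>L p\<close> with as many
  parameters as there are state coordinates leaves a square problem on the fixed space of pairs
  \<open>(x, p)\<close>: solve \<open>traj f N x (L p) = 0\<close> for \<open>p\<close>. Only the existence of a solution matters, so
  the open mapping property takes the place of the implicit function theorem.
\<close>

lemma locally_null_controllable:
  fixes f :: "(real^'n) \<times> (real^'m) \<Rightarrow> real^'n"
  assumes cont: "continuous_on UNIV f"
    and f: "(f has_derivative A) (at (0, 0))" "f (0, 0) = 0"
    and reach: "\<And>y. \<exists>w. traj A N 0 w = y"
  shows "\<forall>\<^sub>F x in nhds 0. \<exists>u. traj f N x u = 0"
proof -
  have A: "linear A"
    using f(1) by (rule has_derivative_linear)
  from reach have "\<forall>i :: 'n. \<exists>w. traj A N 0 w = axis i 1"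
    by blast
  then obtain w where w: "\<And>i :: 'n. traj A N 0 (w i) = axis i 1"
    by metis
  define L where "L k p = (\<Sum>i\<in>UNIV. (p $ i) *\<^sub>R w i k)" for k and p :: "real^'n"
  have L: "bounded_linear (L k)" for k
    unfolding L_def
    by (intro bounded_linear_sum bounded_linear_scaleR_const bounded_linear_vec_nth)
  have reach_L: "traj A N 0 (\<lambda>k. L k p) = p" for p
    unfolding L_def using traj_linear_sum[OF A, of N "\<lambda>i. p $ i" w UNIV]
    by (simp add: w basis_expansion flip: scalar_mult_eq_scaleR)

  define H where "H = (\<lambda>(x, p). (x, traj f N x (\<lambda>k. L k p)))"
  define B where "B x = traj A N x (\<lambda>_. 0)" for x
  have D_split: "traj A N x (\<lambda>k. L k p) = B x + p" for x p
    using traj_linear_add[OF A, of N x 0 "\<lambda>_. 0" "\<lambda>k. L k p"] by (simp add: reach_L B_def)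
  \<comment> \<open>The derivative of \<open>H\<close> at the origin is block triangular with identity diagonal blocks, which
      gives its inverse in closed form.\<close>
  let ?H' = "\<lambda>(x, p). (x, B x + p)" and ?G' = "\<lambda>(x, y). (x, y - B x)"
  have "linear B"
    using traj_linear_add[OF A, of N _ _ "\<lambda>_. 0" "\<lambda>_. 0"]
      traj_linear_scaleR[OF A, of N _ _ "\<lambda>_. 0"]
    by (intro linearI) (auto simp: B_def)
  then have "linear ?G'"
    by (intro linearI) (auto simp: linear_add linear_scale algebra_simps)
  then have G': "bounded_linear ?G'"
    by (rule linear_conv_bounded_linear[THEN iffD1])

  have L_snd: "((\<lambda>z :: (real^'n) \<times> (real^'n). L k (snd z)) has_derivative (\<lambda>z. L k (snd z))) (at z0)"
    for k z0
    by (intro bounded_linear_imp_has_derivative bounded_linear_compose[OF L] bounded_linear_snd)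
  have "((\<lambda>z. traj f N (fst z) (\<lambda>k. L k (snd z))) has_derivative
      (\<lambda>z. traj A N (fst z) (\<lambda>k. L k (snd z)))) (at (0, 0))"
    using traj_has_derivative_at_origin[OF f, of fst fst "(0, 0)" N "\<lambda>k z. L k (snd z)"
        "\<lambda>k z. L k (snd z)"] L_snd
    by (auto simp: has_derivative_fst linear_0[OF bounded_linear.linear[OF L]]
        intro: bounded_linear_imp_has_derivative bounded_linear_fst)
  then have H_deriv: "(H has_derivative ?H') (at (0, 0))"
    unfolding H_def case_prod_unfold D_split
    by (intro has_derivative_Pair bounded_linear_imp_has_derivative[OF bounded_linear_fst])
  have H_cont: "continuous_on UNIV H"
    unfolding H_def case_prod_unfold
    by (intro continuous_intros continuous_on_traj[OF cont]
        bounded_linear.continuous_on[OF L])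
  have "H (0, 0) \<in> interior (H ` UNIV)"
    by (rule sussmann_open_mapping[OF _ H_cont _ H_deriv G']) auto
  moreover have "H (0, 0) = (0, 0)"
    using traj_has_derivative_at_origin[OF f, of "\<lambda>_. 0" "\<lambda>_. 0" 0 N L L]
      bounded_linear_imp_has_derivative[OF L]
    by (simp add: H_def linear_0[OF bounded_linear.linear[OF L]])
  ultimately have "\<forall>\<^sub>F z in nhds (0, 0). z \<in> H ` UNIV"
    using interior_subset by (force simp: eventually_nhds)
  moreover have "((\<lambda>x. (x, 0)) \<longlongrightarrow> (0, 0)) (nhds (0 :: real^'n))"
    by (intro tendsto_intros filterlim_ident)
  ultimately have "\<forall>\<^sub>F x in nhds 0. (x, 0) \<in> H ` UNIV"
    by (rule eventually_compose_filterlim)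
  then show ?thesis
    by eventually_elim (auto simp: H_def)
qed

lemma null_controllable:
  assumes ac: "asymptotically_controllable f"
    and loc: "\<forall>\<^sub>F x in nhds 0. \<exists>u. traj f N x u = 0"
  shows "\<exists>t u. traj f t x u = 0"
proof -
  obtain u where "(\<lambda>t. traj f t x u) \<longlonglongrightarrow> 0"
    using ac by (auto simp: asymptotically_controllable_def)
  with loc have "\<forall>\<^sub>F t in sequentially. \<exists>w. traj f N (traj f t x u) w = 0"
    by (rule eventually_compose_filterlim)
  then obtain s w where "traj f N (traj f s x u) w = 0"
    by (auto simp: eventually_sequentially)
  then show ?thesis
    using traj_concat[of f s N x u w] by auto
qed

section \<open>Minimal-time feedback\<close>

lemma null_controllable_imp_finite_time_stabilizable:
  assumes f0: "f (0, 0) = 0"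
    and nc: "\<And>x. \<exists>t u. traj f t x u = 0"
  shows "finite_time_stabilizable f"
proof -
  define T where "T x = (LEAST t. \<exists>u. traj f t x u = 0)" for x
  have "\<exists>u. traj f (T x) x u = 0" for x
    unfolding T_def using nc[of x] by (rule LeastI_ex)
  then obtain U where U: "\<And>x. traj f (T x) x (U x) = 0"
    by metis
  have T_le: "T x \<le> t" if "traj f t x u = 0" for t x u
    unfolding T_def using that by (intro Least_le) blast
  \<comment> \<open>At the origin the minimal time is zero and \<open>U 0\<close> is arbitrary, whereas a positive number of
      closed-loop steps must lead from the origin to itself.\<close>
  define v where "v x = (if x = 0 then 0 else U x 0)" for x
  have reach: "\<exists>N. closed_loop_traj f v N x = 0" for x
  proof (induction "T x" arbitrary: x rule: less_induct)
    case less
    show ?case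
    proof (cases "x = 0")
      case True
      then show ?thesis by (intro exI[of _ 0]) simp
    next
      case False
      then obtain t where t: "T x = Suc t"
        using U[of x] by (cases "T x") auto
      then have "traj f t (f (x, v x)) (\<lambda>k. U x (Suc k)) = 0"
        using U[of x] False traj_Suc_shift[of f t x "U x"] by (simp add: v_def)
      then have "T (f (x, v x)) < T x"
        using T_le t by fastforce
      then obtain N where "closed_loop_traj f v N (f (x, v x)) = 0"
        using less by blast
      then show ?thesis
        by (metis closed_loop_traj_Suc_shift)
    qed
  qed
  have "\<exists>N>0. closed_loop_traj f v N x = 0" for x
  proof (cases "x = 0")
    case True
    then show ?thesis
      using f0 by (intro exI[of _ 1]) (simp add: v_def)
  next
    case False
    then show ?thesis
      using reach[of x] by (metis closed_loop_traj.simps(1) gr0I)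
  qed
  then show ?thesis
    unfolding finite_time_stabilizable_def by blast
qed

theorem proposition1:
  fixes f :: "(real^'n) \<times> (real^'m) \<Rightarrow> real^'n"
  assumes "C1_map f"
    and "f (0, 0) = 0"
    and "asymptotically_controllable f"
    and "rank_controllable_at_origin f"
  shows "finite_time_stabilizable f"
proof -
  obtain f' where f': "\<And>x. (f has_derivative blinfun_apply (f' x)) (at x)"
    using assms(1) unfolding C1_map_def by blast
  then have cont: "continuous_on UNIV f"
    by (meson has_derivative_continuous continuous_at_imp_continuous_on)
  obtain N where "input_jacobian_rank f N 0 (\<lambda>k\<in>{..<N}. 0) = CARD('n)"
    using assms(4) unfolding rank_controllable_at_origin_def by blast
  then have reach: "\<exists>w. traj (blinfun_apply (f' (0, 0))) N 0 w = y" for y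
    by (intro full_rank_imp_linearization_reachable[OF f' assms(2)]) auto
  show ?thesis
    using null_controllable_imp_finite_time_stabilizable[of f, OF assms(2)]
      null_controllable[OF assms(3) locally_null_controllable[OF cont f' assms(2) reach]]
    by blast
qed

end
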